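(* Let $X$ be a real Banach space with $\dim X\geqslant 2$. Then $$C_{\mathrm{NJ}}(X)=\sup\left\{\frac{2L_X\left(\frac{1-\eta}{2}\right)}{1+\eta^2}: 0\leqslant\eta\leqslant 1\right\},$$ where $L_X$ is extended to $t=\frac12$ by $L_X(\frac12)=\frac12$.
   Context: For $x,y$ in a real Banach space $X$, isosceles orthogonality $x\perp_I y$ means $\|x+y\|=\|x-y\|$. For $0\leqslant t<\frac12$ define $$L_X(t)=\sup\left\{\frac{\|tx+(1-t)y\|^2+\|(1-t)x+ty\|^2}{\|x+y\|^2}: x,y\in X,\ (x,y)\neq(0,0),\ x\perp_I y\right\},$$ and set $L_X(\frac12)=\frac12$. The von Neumann-Jordan constant is $$C_{\mathrm{NJ}}(X)=\sup\left\{\frac{\|x+y\|^2+\|x-y\|^2}{2(\|x\|^2+\|y\|^2)}: x,y\in X,\ (x,y)\neq(0,0)\right\}.$$ *)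

theory Defs
  imports "HOL-Analysis.Analysis"
begin

definition isosceles_orth :: "'a::real_normed_vector \<Rightarrow> 'a \<Rightarrow> bool"  (infix "\<bottom>\<^sub>I" 50)
  where "x \<bottom>\<^sub>I y \<longleftrightarrow> norm (x + y) = norm (x - y)"

(* The space X is passed as the type token TYPE('a).  Only 0 <= t <= 1/2 is meaningful. *)
definition L_const :: "'a::real_normed_vector itself \<Rightarrow> real \<Rightarrow> real"
  where "L_const _ t =
    (if t = 1/2 then 1/2
     else Sup {((norm (t *\<^sub>R x + (1 - t) *\<^sub>R y))\<^sup>2 + (norm ((1 - t) *\<^sub>R x + t *\<^sub>R y))\<^sup>2)
                 / (norm (x + y))\<^sup>2
               | x y :: 'a. (x, y) \<noteq> (0, 0) \<and> x \<bottom>\<^sub>I y})"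

definition C_NJ :: "'a::real_normed_vector itself \<Rightarrow> real"
  where "C_NJ _ =
    Sup {((norm (x + y))\<^sup>2 + (norm (x - y))\<^sup>2) / (2 * ((norm x)\<^sup>2 + (norm y)\<^sup>2))
         | x y :: 'a. (x, y) \<noteq> (0, 0)}"

text \<open>The supremum on the reals is the true one only for nonempty sets that are bounded above.
  The following facts show that this is the case for every set whose supremum occurs here (the outermost
  one, over \<open>\<eta>\<close> with \<open>t = (1 - \<eta>) / 2\<close>, is nonempty trivially).\<close>

lemma C_NJ_ratio_le:
  fixes x y :: "'a::real_normed_vector"
  assumes nz: "(x, y) \<noteq> (0, 0)"
  shows "((norm (x + y))\<^sup>2 + (norm (x - y))\<^sup>2) / (2 * ((norm x)\<^sup>2 + (norm y)\<^sup>2)) \<le> 2"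
proof -
  have "(norm (x + y))\<^sup>2 \<le> (norm x + norm y)\<^sup>2" "(norm (x - y))\<^sup>2 \<le> (norm x + norm y)\<^sup>2"
    by (simp_all add: power_mono norm_triangle_ineq norm_triangle_ineq4)
  moreover have "(norm x + norm y)\<^sup>2 \<le> 2 * ((norm x)\<^sup>2 + (norm y)\<^sup>2)"
    using sum_squares_bound[of "norm x" "norm y"] by (simp add: power2_sum)
  ultimately have "(norm (x + y))\<^sup>2 + (norm (x - y))\<^sup>2 \<le> 2 * (2 * ((norm x)\<^sup>2 + (norm y)\<^sup>2))"
    by linarith
  moreover have "2 * ((norm x)\<^sup>2 + (norm y)\<^sup>2) > 0"
    using nz sum_power2_gt_zero_iff[of "norm x" "norm y"] by (simp only: norm_eq_zero) simp
  ultimately show "((norm (x + y))\<^sup>2 + (norm (x - y))\<^sup>2) / (2 * ((norm x)\<^sup>2 + (norm y)\<^sup>2)) \<le> 2"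
    by (simp only: pos_divide_le_eq)
qed

lemma C_NJ_bdd_above:
  "bdd_above {((norm (x + y))\<^sup>2 + (norm (x - y))\<^sup>2) / (2 * ((norm x)\<^sup>2 + (norm y)\<^sup>2))
         | x y :: 'a::real_normed_vector. (x, y) \<noteq> (0, 0)}"
  using C_NJ_ratio_le by (intro bdd_aboveI[where M = 2]) blast

lemma C_NJ_nonempty:
  assumes "(z :: 'a::real_normed_vector) \<noteq> 0"
  shows "{((norm (x + y))\<^sup>2 + (norm (x - y))\<^sup>2) / (2 * ((norm x)\<^sup>2 + (norm y)\<^sup>2))
         | x y :: 'a. (x, y) \<noteq> (0, 0)} \<noteq> {}"
  using assms by blast

lemma isosceles_orth_norms:
  assumes "x \<bottom>\<^sub>I y"
  shows "norm x \<le> norm (x + y)" "norm y \<le> norm (x + y)"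
proof -
  have eq: "norm (x - y) = norm (x + y)" using assms by (simp add: isosceles_orth_def)
  have "norm (2 *\<^sub>R x) \<le> norm (x + y) + norm (x - y)"
    using norm_triangle_ineq[of "x + y" "x - y"] by (simp add: scaleR_2)
  then show "norm x \<le> norm (x + y)" using eq by simp
  have "norm (2 *\<^sub>R y) \<le> norm (x + y) + norm (x - y)"
    using norm_triangle_ineq4[of "x + y" "x - y"] by (simp add: scaleR_2)
  then show "norm y \<le> norm (x + y)" using eq by simp
qed

lemma L_const_ratio_le:
  fixes x y :: "'a::real_normed_vector"
  assumes "0 \<le> t" "t \<le> 1/2" and nz: "(x, y) \<noteq> (0, 0)" and orth: "x \<bottom>\<^sub>I y"
  shows "((norm (t *\<^sub>R x + (1 - t) *\<^sub>R y))\<^sup>2 + (norm ((1 - t) *\<^sub>R x + t *\<^sub>R y))\<^sup>2)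
           / (norm (x + y))\<^sup>2 \<le> 2"
proof -
  let ?n = "norm (x + y)"
  have le: "norm (s *\<^sub>R x + (1 - s) *\<^sub>R y) \<le> ?n" if "0 \<le> s" "s \<le> 1" for s
  proof -
    have "norm (s *\<^sub>R x + (1 - s) *\<^sub>R y) \<le> s * norm x + (1 - s) * norm y"
      using norm_triangle_ineq[of "s *\<^sub>R x" "(1 - s) *\<^sub>R y"] that by simp
    also have "\<dots> \<le> s * ?n + (1 - s) * ?n"
      using that isosceles_orth_norms[OF orth] by (intro add_mono mult_left_mono) auto
    finally show ?thesis by (simp add: algebra_simps)
  qed
  have "?n > 0"
    using nz isosceles_orth_norms[OF orth] by (metis norm_le_zero_iff not_le_imp_less order_trans)
  moreover have "(norm (t *\<^sub>R x + (1 - t) *\<^sub>R y))\<^sup>2 \<le> ?n\<^sup>2" "(norm ((1 - t) *\<^sub>R x + t *\<^sub>R y))\<^sup>2 \<le> ?n\<^sup>2"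
    using le[of t] le[of "1 - t"] assms by (simp_all add: power_mono)
  ultimately show "((norm (t *\<^sub>R x + (1 - t) *\<^sub>R y))\<^sup>2 + (norm ((1 - t) *\<^sub>R x + t *\<^sub>R y))\<^sup>2) / ?n\<^sup>2 \<le> 2"
    by (subst pos_divide_le_eq) (simp, linarith)
qed

lemma L_const_bdd_above:
  assumes "0 \<le> t" "t \<le> 1/2"
  shows "bdd_above {((norm (t *\<^sub>R x + (1 - t) *\<^sub>R y))\<^sup>2 + (norm ((1 - t) *\<^sub>R x + t *\<^sub>R y))\<^sup>2)
                 / (norm (x + y))\<^sup>2
               | x y :: 'a::real_normed_vector. (x, y) \<noteq> (0, 0) \<and> x \<bottom>\<^sub>I y}"
  using L_const_ratio_le[OF assms] by (intro bdd_aboveI[where M = 2]) blast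

lemma L_const_nonempty:
  assumes "(z :: 'a::real_normed_vector) \<noteq> 0"
  shows "{((norm (t *\<^sub>R x + (1 - t) *\<^sub>R y))\<^sup>2 + (norm ((1 - t) *\<^sub>R x + t *\<^sub>R y))\<^sup>2)
                 / (norm (x + y))\<^sup>2
               | x y :: 'a. (x, y) \<noteq> (0, 0) \<and> x \<bottom>\<^sub>I y} \<noteq> {}"
proof -
  have "z \<bottom>\<^sub>I 0" by (simp add: isosceles_orth_def)
  with assms show ?thesis by blast
qed

lemma outer_sup_bdd_above:
  assumes "(z :: 'a::real_normed_vector) \<noteq> 0"
  shows "bdd_above {2 * L_const TYPE('a) ((1 - \<eta>) / 2) / (1 + \<eta>\<^sup>2) | \<eta>. 0 \<le> \<eta> \<and> \<eta> \<le> 1}"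
proof (rule bdd_aboveI[where M = 4], clarify)
  fix \<eta> :: real
  assume \<eta>: "0 \<le> \<eta>" "\<eta> \<le> 1"
  define t where "t = (1 - \<eta>) / 2"
  have t: "0 \<le> t" "t \<le> 1/2" using \<eta> by (auto simp: t_def)
  have "Sup {((norm (t *\<^sub>R x + (1 - t) *\<^sub>R y))\<^sup>2 + (norm ((1 - t) *\<^sub>R x + t *\<^sub>R y))\<^sup>2)
                 / (norm (x + y))\<^sup>2
               | x y :: 'a. (x, y) \<noteq> (0, 0) \<and> x \<bottom>\<^sub>I y} \<le> 2"
    by (rule cSup_least[OF L_const_nonempty[OF assms]]) (use L_const_ratio_le[OF t] in blast)
  then have "L_const TYPE('a) t \<le> 2" by (simp add: L_const_def)
  then have "2 * L_const TYPE('a) t \<le> 4 * 1" by simp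
  also have "\<dots> \<le> 4 * (1 + \<eta>\<^sup>2)" by simp
  finally have "2 * L_const TYPE('a) t / (1 + \<eta>\<^sup>2) \<le> 4"
    by (simp add: pos_divide_le_eq add_pos_nonneg)
  then show "2 * L_const TYPE('a) ((1 - \<eta>) / 2) / (1 + \<eta>\<^sup>2) \<le> 4" by (simp only: t_def)
qed

end

theory Submission
  imports Defs
begin

text \<open>Put \<open>u = x + y\<close> and \<open>v = x - y\<close>. Then \<open>x \<bottom>\<^sub>I y\<close> says \<open>\<parallel>u\<parallel> = \<parallel>v\<parallel>\<close>, and for \<open>t = (1 - \<eta>) / 2\<close> the two
  convex combinations in \<open>L_const\<close> are \<open>(u \<mp> \<eta> v) / 2\<close>. So \<open>2 / (1 + \<eta>\<^sup>2)\<close> times the quotient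
  defining \<open>L_const\<close> is the von Neumann-Jordan quotient of the pair \<open>(u, \<eta> v)\<close>. Conversely, up to order,
  every nonzero pair has the form \<open>(u, \<eta> v)\<close> with \<open>\<parallel>u\<parallel> = \<parallel>v\<parallel>\<close> and \<open>0 \<le> \<eta> \<le> 1\<close>.\<close>

definition NJ_ratio :: "'a::real_normed_vector \<Rightarrow> 'a \<Rightarrow> real"
  where "NJ_ratio x y = ((norm (x + y))\<^sup>2 + (norm (x - y))\<^sup>2) / (2 * ((norm x)\<^sup>2 + (norm y)\<^sup>2))"

definition L_ratio :: "real \<Rightarrow> 'a::real_normed_vector \<Rightarrow> 'a \<Rightarrow> real"
  where "L_ratio t x y =
    ((norm (t *\<^sub>R x + (1 - t) *\<^sub>R y))\<^sup>2 + (norm ((1 - t) *\<^sub>R x + t *\<^sub>R y))\<^sup>2) / (norm (x + y))\<^sup>2"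

lemma NJ_ratio_commute: "NJ_ratio x y = NJ_ratio y x"
  by (simp add: NJ_ratio_def add.commute norm_minus_commute)

lemma NJ_ratio_0_right: "x \<noteq> 0 \<Longrightarrow> NJ_ratio x 0 = 1"
  by (simp add: NJ_ratio_def)

lemma NJ_ratio_eq_L_ratio:
  fixes x y :: "'a::real_normed_vector"
  assumes "x \<bottom>\<^sub>I y"
  shows "NJ_ratio (x + y) (\<eta> *\<^sub>R (x - y)) = 2 * L_ratio ((1 - \<eta>) / 2) x y / (1 + \<eta>\<^sup>2)"
proof -
  define p where "p = ((1 - \<eta>) / 2) *\<^sub>R x + (1 - (1 - \<eta>) / 2) *\<^sub>R y"
  define q where "q = (1 - (1 - \<eta>) / 2) *\<^sub>R x + ((1 - \<eta>) / 2) *\<^sub>R y"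
  have half: "1 - (1 - \<eta>) / 2 = (1 + \<eta>) / 2"
    by (simp add: field_simps)
  have dbl: "2 *\<^sub>R (c / 2) *\<^sub>R w = c *\<^sub>R w" for c :: real and w :: 'a
    by simp
  have minus: "x + y - \<eta> *\<^sub>R (x - y) = 2 *\<^sub>R p" and plus: "x + y + \<eta> *\<^sub>R (x - y) = 2 *\<^sub>R q"
    unfolding p_def q_def half scaleR_add_right dbl by (simp_all add: algebra_simps)
  \<comment> \<open>Orthogonality makes \<open>(norm (x + y))\<^sup>2\<close> a common factor of the
    denominator. The 4 below comes from squaring the norms of \<open>2 *\<^sub>R p\<close> and
    \<open>2 *\<^sub>R q\<close>.\<close>
  have "norm (x - y) = norm (x + y)"
    using assms by (simp add: isosceles_orth_def)
  then have "(norm (x + y))\<^sup>2 + (norm (\<eta> *\<^sub>R (x - y)))\<^sup>2 = (1 + \<eta>\<^sup>2) * (norm (x + y))\<^sup>2"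
    by (simp add: power_mult_distrib distrib_right)
  then have "NJ_ratio (x + y) (\<eta> *\<^sub>R (x - y)) =
      (4 * ((norm p)\<^sup>2 + (norm q)\<^sup>2)) / (2 * ((1 + \<eta>\<^sup>2) * (norm (x + y))\<^sup>2))"
    by (simp add: NJ_ratio_def plus minus power_mult_distrib)
  then show ?thesis
    by (simp add: L_ratio_def mult.commute del: distrib_left_numeral distrib_right_numeral flip: p_def q_def)
qed

lemma NJ_ratio_le_C_NJ:
  fixes x y :: "'a::real_normed_vector"
  assumes "(x, y) \<noteq> (0, 0)"
  shows "NJ_ratio x y \<le> C_NJ TYPE('a)"
  unfolding C_NJ_def NJ_ratio_def
  by (rule cSup_upper[OF _ C_NJ_bdd_above]) (use assms in blast)

lemma C_NJ_le:
  assumes "(z :: 'a::real_normed_vector) \<noteq> 0"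
    and "\<And>x y :: 'a. (x, y) \<noteq> (0, 0) \<Longrightarrow> NJ_ratio x y \<le> c"
  shows "C_NJ TYPE('a) \<le> c"
  unfolding C_NJ_def
  by (rule cSup_least[OF C_NJ_nonempty[OF assms(1)]]) (use assms(2) in \<open>auto simp: NJ_ratio_def\<close>)

lemma L_ratio_le_L_const:
  fixes x y :: "'a::real_normed_vector"
  assumes "0 \<le> t" "t < 1/2" "(x, y) \<noteq> (0, 0)" "x \<bottom>\<^sub>I y"
  shows "L_ratio t x y \<le> L_const TYPE('a) t"
proof -
  have "t \<le> 1/2" "t \<noteq> 1/2" using assms(2) by auto
  then show ?thesis
    unfolding L_const_def L_ratio_def using assms
    by (simp only: if_False) (rule cSup_upper[OF _ L_const_bdd_above], blast+)
qed

lemma L_const_le: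
  assumes "(z :: 'a::real_normed_vector) \<noteq> 0" "t \<noteq> 1/2"
    and "\<And>x y :: 'a. (x, y) \<noteq> (0, 0) \<Longrightarrow> x \<bottom>\<^sub>I y \<Longrightarrow> L_ratio t x y \<le> c"
  shows "L_const TYPE('a) t \<le> c"
  unfolding L_const_def if_not_P[OF assms(2)]
  by (rule cSup_least[OF L_const_nonempty[OF assms(1)]]) (use assms(3) in \<open>auto simp: L_ratio_def\<close>)

text \<open>Every quotient entering \<open>L_const\<close> is, after scaling, the quotient of a pair
  that competes in \<open>C_NJ\<close>.\<close>

lemma scaled_L_const_le_C_NJ:
  fixes z :: "'a::real_normed_vector"
  assumes "z \<noteq> 0" "0 \<le> \<eta>"
  shows "2 * L_const TYPE('a) ((1 - \<eta>) / 2) / (1 + \<eta>\<^sup>2) \<le> C_NJ TYPE('a)"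
proof (cases "\<eta> = 0")
  case True
  \<comment> \<open>Here \<open>t = 1/2\<close>, and the value 1/2 fixed for \<open>L_const\<close>
    makes the left side 1, which the pair \<open>(z, 0)\<close> attains.\<close>
  then show ?thesis
    using NJ_ratio_le_C_NJ[of z 0] assms(1) by (simp add: NJ_ratio_0_right L_const_def)
next
  case False
  have pos: "0 < 1 + \<eta>\<^sup>2" by (simp add: add_pos_nonneg)
  have "L_const TYPE('a) ((1 - \<eta>) / 2) \<le> C_NJ TYPE('a) * (1 + \<eta>\<^sup>2) / 2"
  proof (rule L_const_le[OF assms(1)])
    show "(1 - \<eta>) / 2 \<noteq> 1/2" using False by simp
  next
    fix x y :: 'a
    assume nz: "(x, y) \<noteq> (0, 0)" and orth: "x \<bottom>\<^sub>I y"
    \<comment> \<open>Orthogonality bounds \<open>norm x\<close> and \<open>norm y\<close> by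
      \<open>norm (x + y)\<close>, so a zero sum would force \<open>x = y = 0\<close>.\<close>
    have "x + y \<noteq> 0"
      using nz isosceles_orth_norms[OF orth] by auto
    then have "NJ_ratio (x + y) (\<eta> *\<^sub>R (x - y)) \<le> C_NJ TYPE('a)"
      by (intro NJ_ratio_le_C_NJ) simp
    then show "L_ratio ((1 - \<eta>) / 2) x y \<le> C_NJ TYPE('a) * (1 + \<eta>\<^sup>2) / 2"
      using pos by (simp add: NJ_ratio_eq_L_ratio[OF orth] pos_divide_le_eq)
  qed
  then show ?thesis using pos by (simp add: pos_divide_le_eq)
qed

text \<open>The converse direction: one member of the outer set already dominates the given
  quotient.\<close>

lemma NJ_ratio_le_scaled_L_const:
  fixes x y :: "'a::real_normed_vector"
  assumes "x \<noteq> 0" "norm y \<le> norm x"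
  obtains \<eta> where "0 \<le> \<eta>" "\<eta> \<le> 1"
    "NJ_ratio x y \<le> 2 * L_const TYPE('a) ((1 - \<eta>) / 2) / (1 + \<eta>\<^sup>2)"
proof (cases "y = 0")
  case True
  show thesis
    \<comment> \<open>At \<eta> = 0 the bound is 1, again by the convention at
      \<open>t = 1/2\<close>.\<close>
    by (rule that[of 0]) (use True assms(1) in \<open>simp_all add: NJ_ratio_0_right L_const_def\<close>)
next
  case False
  \<comment> \<open>Rescaling \<open>y\<close> to the length of \<open>x\<close> gives
    \<open>v\<close>; then \<open>a\<close> and \<open>b\<close> solve \<open>a + b = x\<close>,
    \<open>a - b = v\<close>, and equal lengths of \<open>x\<close> and \<open>v\<close> mean
    \<open>a \<bottom>\<^sub>I b\<close>.\<close>
  define \<eta> where "\<eta> = norm y / norm x"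
  define v where "v = inverse \<eta> *\<^sub>R y"
  define a b where "a = (1/2) *\<^sub>R (x + v)" and "b = (1/2) *\<^sub>R (x - v)"
  have \<eta>: "0 < \<eta>" "\<eta> \<le> 1"
    using False assms by (auto simp: \<eta>_def)
  have sum: "a + b = x" and diff: "a - b = v"
    by (simp_all add: a_def b_def algebra_simps flip: scaleR_add_left)
  have "norm v = norm x"
    using False by (simp add: v_def \<eta>_def)
  then have orth: "a \<bottom>\<^sub>I b"
    by (simp add: isosceles_orth_def sum diff)
  have "NJ_ratio x y = NJ_ratio (a + b) (\<eta> *\<^sub>R (a - b))"
    using \<eta>(1) by (simp add: sum diff v_def)
  also have "\<dots> = 2 * L_ratio ((1 - \<eta>) / 2) a b / (1 + \<eta>\<^sup>2)"
    by (rule NJ_ratio_eq_L_ratio[OF orth])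
  also have "\<dots> \<le> 2 * L_const TYPE('a) ((1 - \<eta>) / 2) / (1 + \<eta>\<^sup>2)"
  proof (intro divide_right_mono mult_left_mono L_ratio_le_L_const orth)
    show "(a, b) \<noteq> (0, 0)" using sum assms(1) by auto
  qed (use \<eta> in auto)
  finally show thesis using that[of \<eta>] \<eta> by simp
qed

theorem theorem4:
  assumes "\<exists>B :: 'a::banach set. independent B \<and> card B = 2"
  shows "C_NJ TYPE('a) =
    Sup {2 * L_const TYPE('a) ((1 - \<eta>) / 2) / (1 + \<eta>\<^sup>2) | \<eta>. 0 \<le> \<eta> \<and> \<eta> \<le> 1}"
    (is "_ = Sup ?S")
proof (rule antisym)
  obtain B :: "'a set" where B: "independent B" "card B = 2" using assms by blast
  then obtain z where "z \<in> B" by fastforce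
  \<comment> \<open>A nonzero vector keeps the sets behind \<open>C_NJ\<close> and
    \<open>L_const\<close> nonempty, so that their suprema are genuine.\<close>
  with B(1) have z: "z \<noteq> 0" using dependent_zero by blast
  show "C_NJ TYPE('a) \<le> Sup ?S"
  proof (rule C_NJ_le[OF z])
    fix x y :: 'a
    assume "(x, y) \<noteq> (0, 0)"
    \<comment> \<open>The longer vector of a nonzero pair is nonzero; by symmetry of
      \<open>NJ_ratio\<close> it may be put first.\<close>
    then consider "x \<noteq> 0" "norm y \<le> norm x" | "y \<noteq> 0" "norm x \<le> norm y"
      by (cases "norm y \<le> norm x") force+
    then obtain \<eta> where "0 \<le> \<eta>" "\<eta> \<le> 1"
      and le: "NJ_ratio x y \<le> 2 * L_const TYPE('a) ((1 - \<eta>) / 2) / (1 + \<eta>\<^sup>2)"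
      by cases (metis NJ_ratio_le_scaled_L_const NJ_ratio_commute)+
    then have "2 * L_const TYPE('a) ((1 - \<eta>) / 2) / (1 + \<eta>\<^sup>2) \<le> Sup ?S"
      by (intro cSup_upper[OF _ outer_sup_bdd_above[OF z]]) blast
    with le show "NJ_ratio x y \<le> Sup ?S" by (rule order_trans)
  qed
  show "Sup ?S \<le> C_NJ TYPE('a)"
  proof (rule cSup_least)
    show "?S \<noteq> {}" by (auto intro: exI[of _ 0])
  qed (use scaled_L_const_le_C_NJ[OF z] in blast)
qed

end
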